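(* Let $a_2,a_3$ be integers with $1<a_2<a_3$, $A=\{1,a_2,a_3\}$, and let $h$ be a positive integer with $X(h)\ge a_3$. Write $X(h)=(k+1)a_3+Y$ with integers $k$ and $0\le Y<a_3$, and let $p$ be the integer for which $SG(A,h-k,p)$ is a stride generator (the stride generator underlying the $h$-basis). Then this stride generator is canonical, i.e. all its breaks are canonical.
   Context: An integer $x$ has an $h$-representation if $x=c_3a_3+c_2a_2+c_1$ with integers $c_1,c_2,c_3\ge0$ and $c_1+c_2+c_3\le h$. $X(h)$ is one less than the smallest positive integer with no $h$-representation. For integers $n$ and $i\ge 0$, an integer $x$ has an $n$-generation of order $i$ if there are integers $c_1,c_2\ge 0$ with $x+ia_3=c_2a_2+c_1$ and $c_1+c_2\le n+i$. For integers $n$ and $p\ge0$, $SG(A,n,p)$ is a stride generator if: (A) every integer $0\le x<a_3$ has an $n$-generation of some order $\le p$; (B) at least one integer $0\le x<a_3$ has no $n$-generation of order $<p$; (C) at least one integer $0\le y<a_3$ has no $(n-1)$-generation of any order $\le p+1$. (Conditions (A),(B) determine $p$ uniquely from $n$.) Any $0\le y<a_3$ satisfying (C) is called a break. A break $y$ is canonical if there is no integer $j\ge 0$ with $y+ja_3=c_2a_2+c_1$, $c_1,c_2\ge 0$, $c_1+c_2\le (n-1)+j$. A stride generator is canonical if all its breaks are canonical. *)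

theory Defs
  imports Main
begin

text \<open>Throughout, A = {1, a2, a3}; the set A is represented by the two integers a2, a3.\<close>

definition h_rep :: "int \<Rightarrow> int \<Rightarrow> int \<Rightarrow> int \<Rightarrow> bool" where
  "h_rep a2 a3 h x \<longleftrightarrow> (\<exists>c1 c2 c3::int. c1 \<ge> 0 \<and> c2 \<ge> 0 \<and> c3 \<ge> 0 \<and>
      x = c3 * a3 + c2 * a2 + c1 \<and> c1 + c2 + c3 \<le> h)"

definition Xh :: "int \<Rightarrow> int \<Rightarrow> int \<Rightarrow> int" where
  "Xh a2 a3 h = (LEAST x::int. x > 0 \<and> \<not> h_rep a2 a3 h x) - 1"

definition n_gen :: "int \<Rightarrow> int \<Rightarrow> int \<Rightarrow> nat \<Rightarrow> int \<Rightarrow> bool" where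
  "n_gen a2 a3 n i x \<longleftrightarrow> (\<exists>c1 c2::int. c1 \<ge> 0 \<and> c2 \<ge> 0 \<and>
      x + int i * a3 = c2 * a2 + c1 \<and> c1 + c2 \<le> n + int i)"

definition stride_generator :: "int \<Rightarrow> int \<Rightarrow> int \<Rightarrow> nat \<Rightarrow> bool" where
  "stride_generator a2 a3 n p \<longleftrightarrow>
     (\<forall>x. 0 \<le> x \<and> x < a3 \<longrightarrow> (\<exists>i\<le>p. n_gen a2 a3 n i x)) \<and>
     (\<exists>x. 0 \<le> x \<and> x < a3 \<and> \<not> (\<exists>i<p. n_gen a2 a3 n i x)) \<and>
     (\<exists>y. 0 \<le> y \<and> y < a3 \<and> \<not> (\<exists>i\<le>p + 1. n_gen a2 a3 (n - 1) i y))"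

definition is_break :: "int \<Rightarrow> int \<Rightarrow> int \<Rightarrow> nat \<Rightarrow> int \<Rightarrow> bool" where
  "is_break a2 a3 n p y \<longleftrightarrow>
     0 \<le> y \<and> y < a3 \<and> \<not> (\<exists>i\<le>p + 1. n_gen a2 a3 (n - 1) i y)"

definition canonical_break :: "int \<Rightarrow> int \<Rightarrow> int \<Rightarrow> int \<Rightarrow> bool" where
  "canonical_break a2 a3 n y \<longleftrightarrow> \<not> (\<exists>j. n_gen a2 a3 (n - 1) j y)"

definition canonical_SG :: "int \<Rightarrow> int \<Rightarrow> int \<Rightarrow> nat \<Rightarrow> bool" where
  "canonical_SG a2 a3 n p \<longleftrightarrow>
     stride_generator a2 a3 n p \<and> (\<forall>y. is_break a2 a3 n p y \<longrightarrow> canonical_break a2 a3 n y)"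

end

theory Submission
  imports Defs
begin

text \<open>
  Write a point (c, i) of the integer lattice as the residue D = c * a2 - i * a3 together with
  f = D - (c - i).  For x \<ge> n, an n-generation of x of order i is a point (c, i) with D \<le> x and
  f \<ge> x - n, so generations are lattice points in a quadrant, and differences of such points can
  be added to other points.  Let y be a break whose least (n-1)-generation P has order j.
  Firstly, no lattice vector of order between 1 and j has D \<ge> 0 and f \<le> 0, since subtracting it
  from P would lower the order.  Hence the vectors of orders 1, ..., j - 1 take distinct values of
  D and of f, and counting the available values gives j \<le> k + 1.  So Y + 1, which has no
  (n-1)-generation of order at most k + 1, is a canonical break.
  Secondly, a canonical break z cannot coexist with y: let Q and S be the points of order below j
  that generate y and y + 1, and Qz and Sz those for z and z + 1.  Adding combinations of P - Q,
  S - P and Sz - Qz to these points either gives a point in a quadrant that has to be empty, or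
  contradicts the fact that c - i grows with the order i.
\<close>

section \<open>Generations as lattice points\<close>

locale two_steps =
  fixes a2 a3 :: int
  assumes a2_gt_1: "1 < a2" and a2_less_a3: "a2 < a3"
begin

definition D :: "int \<Rightarrow> int \<Rightarrow> int" where
  "D c i = c * a2 - i * a3"

definition f :: "int \<Rightarrow> int \<Rightarrow> int" where
  "f c i = D c i - (c - i)"

lemma D_add: "D (c + c') (i + i') = D c i + D c' i'"
  and D_diff: "D (c - c') (i - i') = D c i - D c' i'"
  by (simp_all add: D_def algebra_simps)

lemma f_add: "f (c + c') (i + i') = f c i + f c' i'"
  and f_diff: "f (c - c') (i - i') = f c i - f c' i'"
  by (simp_all add: f_def D_add D_diff)

lemma D_order: "(c - i) * a2 = D c i + i * (a3 - a2)"
  by (simp add: D_def algebra_simps)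

lemma excess_pos:
  assumes "0 \<le> D c i" and "0 < i"
  shows "0 < c - i"
proof -
  have "0 < i * (a3 - a2)" using assms a2_less_a3 by simp
  then have "0 < (c - i) * a2" using D_order[of c i] assms by linarith
  then show ?thesis using a2_gt_1 by (simp add: zero_less_mult_iff)
qed

text \<open>In \<open>D_order\<close> the orders contribute at least \<open>a3 - a2\<close> and the
  change of \<open>D\<close> more than \<open>-a3\<close>, so \<open>(c - i) * a2\<close> falls by
  less than \<open>a2\<close>.\<close>

lemma excess_mono:
  assumes "i < i'" and "D c i < a3" and "0 \<le> D c' i'"
  shows "c - i \<le> c' - i'"
proof -
  have "1 * (a3 - a2) \<le> (i' - i) * (a3 - a2)"
    using assms(1) a2_less_a3 by (intro mult_right_mono) auto
  then have "(c - i) * a2 < (c' - i') * a2 + 1 * a2"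
    using D_order[of c i] D_order[of c' i'] assms(2,3) by (simp add: left_diff_distrib)
  then have "(c - i) * a2 < (c' - i' + 1) * a2" by (simp add: algebra_simps)
  then have "c - i < c' - i' + 1" using a2_gt_1 by (simp add: mult_less_cancel_right)
  then show ?thesis by simp
qed

text \<open>If \<open>D\<close> < 0 while \<open>f\<close> \<ge> 0, then \<open>c - i\<close> < 0,
  and \<open>D_order\<close> gives \<open>D\<close> \<le> \<open>(c - i) * a2\<close> <
  \<open>c - i\<close>, that is, \<open>f\<close> < 0.\<close>

lemma D_nonneg:
  assumes "0 \<le> f c i" and "0 \<le> i"
  shows "0 \<le> D c i"
proof (rule ccontr)
  assume neg: "\<not> 0 \<le> D c i"
  then have "c - i < 0" using assms(1) by (simp add: f_def)
  then have le: "c - i \<le> -1" by simp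
  have "0 \<le> i * (a3 - a2)" using assms(2) a2_less_a3 by simp
  then have "D c i \<le> (c - i) * a2" using D_order[of c i] by linarith
  also have "(c - i) * a2 < c - i"
    using le a2_gt_1 by (simp add: mult_less_cancel_left1)
  finally show False using assms(1) by (simp add: f_def)
qed

text \<open>The sign of \<open>c\<close> comes for free: \<open>n\<close> \<le> \<open>x\<close>
  makes \<open>f\<close> nonnegative, hence \<open>D\<close>, hence \<open>c\<close>.\<close>

lemma n_genI:
  assumes "0 \<le> i" and "D c i \<le> x" and "x - n \<le> f c i" and "n \<le> x"
  shows "n_gen a2 a3 n (nat i) x"
proof -
  have "0 \<le> D c i" using D_nonneg assms by simp
  then have "0 \<le> c * a2" using assms(1) a2_gt_1 a2_less_a3
    by (smt (verit) D_def mult_nonneg_nonneg)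
  then have "0 \<le> c" using a2_gt_1 by (simp add: zero_le_mult_iff)
  moreover have "x + i * a3 = c * a2 + (x - D c i)" by (simp add: D_def)
  ultimately show ?thesis
    unfolding n_gen_def using assms
    by - (rule exI[of _ "x - D c i"], rule exI[of _ c], simp add: f_def)
qed

lemma n_genE:
  assumes "n_gen a2 a3 n i x"
  obtains c where "D c (int i) \<le> x" and "x - n \<le> f c (int i)"
proof -
  from assms obtain c1 c2 where "c1 \<ge> 0" "x + int i * a3 = c2 * a2 + c1" "c1 + c2 \<le> n + int i"
    unfolding n_gen_def by blast
  then have "D c2 (int i) \<le> x" "x - n \<le> f c2 (int i)" by (simp_all add: D_def f_def)
  then show thesis by (rule that)
qed

lemma no_gen_0_ge:
  assumes "\<not> n_gen a2 a3 (n - 1) 0 y" and "0 \<le> y"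
  shows "n \<le> y"
proof (rule ccontr)
  assume "\<not> n \<le> y"
  then have "n_gen a2 a3 (n - 1) 0 y"
    unfolding n_gen_def using assms(2) by - (rule exI[of _ y], rule exI[of _ 0], simp)
  with assms(1) show False by simp
qed

end

section \<open>Breaks first generated at a positive order, and a bound on that order\<close>

locale late_break = two_steps +
  fixes n y :: int and j :: nat
  assumes y_range: "0 \<le> y" "y < a3"
    and gen_j: "n_gen a2 a3 (n - 1) j y"
    and j_pos: "0 < j"
    and no_gen_below_j: "\<And>i. i < j \<Longrightarrow> \<not> n_gen a2 a3 (n - 1) i y"
begin

lemma n_le_y: "n \<le> y"
  using no_gen_0_ge no_gen_below_j j_pos y_range by blast

lemma no_point_below_j:
  assumes "0 \<le> i" and "i < int j" and "D c i \<le> y"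
  shows "f c i \<le> y - n"
proof (rule ccontr)
  assume "\<not> f c i \<le> y - n"
  then have "n_gen a2 a3 (n - 1) (nat i) y"
    using assms n_le_y by (intro n_genI) auto
  moreover have "nat i < j" using assms by simp
  ultimately show False using no_gen_below_j by blast
qed

lemma obtain_P:
  obtains cP where "D cP (int j) \<le> y" and "y - n + 1 \<le> f cP (int j)" and "0 \<le> D cP (int j)"
proof -
  obtain c where "D c (int j) \<le> y" "y - (n - 1) \<le> f c (int j)"
    using gen_j by (rule n_genE)
  moreover from this have "0 \<le> D c (int j)" using n_le_y by (intro D_nonneg) auto
  ultimately show thesis using that by simp
qed

lemma f_pos:
  assumes "1 \<le> i" and "i \<le> int j" and "0 \<le> D c i"
  shows "1 \<le> f c i"
proof (rule ccontr)
  assume "\<not> 1 \<le> f c i"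
  moreover obtain cP where "D cP (int j) \<le> y" "y - n + 1 \<le> f cP (int j)" by (rule obtain_P)
  moreover have "D (cP - c) (int j - i) \<le> y" using calculation assms by (simp add: D_diff)
  moreover from this have "f (cP - c) (int j - i) \<le> y - n"
    using assms by (intro no_point_below_j) auto
  ultimately show False by (simp add: f_diff)
qed

text \<open>With \<open>D\<close> = 0 one has \<open>f\<close> = \<open>-(c - i)\<close> < 0 by
  \<open>excess_pos\<close>, against \<open>f_pos\<close>. Applied to differences, this separates
  the values of \<open>D\<close> at different orders.\<close>

lemma D_ne_0:
  assumes "1 \<le> i" and "i \<le> int j"
  shows "D c i \<noteq> 0"
proof
  assume "D c i = 0"
  then show False using f_pos[OF assms, of c] excess_pos[of c i] assms(1) by (simp add: f_def)
qed

text \<open>Each order from 1 to \<open>j - 1\<close> has one vector with \<open>D\<close> in [0,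
  \<open>a2\<close>). Those with \<open>D\<close> above \<open>y mod a2\<close> are counted by
  \<open>D\<close>, the others by \<open>f\<close>. \<open>T\<close> is a parameter so that an
  unattainable value of \<open>D\<close> can be left out.\<close>

lemma order_bound_aux:
  assumes T: "T \<subseteq> {y mod a2 <.. a2 - 1}"
    and avoid: "\<And>i c. 1 \<le> i \<Longrightarrow> i < int j \<Longrightarrow> y mod a2 < D c i \<Longrightarrow> D c i < a2 \<Longrightarrow> D c i \<in> T"
  shows "int j \<le> 1 + int (card T) + (y mod a2 + y div a2 - n)"
proof -
  define v U where "v = y mod a2" and "U = y div a2"
  have y_eq: "y = U * a2 + v" by (simp add: U_def v_def)
  have v: "0 \<le> v" "v < a2" using a2_gt_1 by (simp_all add: v_def)
  define c where "c i = - ((- (i * a3)) div a2)" for i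
  have Dc: "D (c i) i = (- (i * a3)) mod a2" for i
    using minus_div_mult_eq_mod[of "- (i * a3)" a2] by (simp add: D_def c_def)
  have Dc_range: "0 \<le> D (c i) i" "D (c i) i < a2" for i
    using a2_gt_1 by (simp_all add: Dc)
  \<comment> \<open>The shift by \<open>U\<close> takes a vector with \<open>D\<close> \<le>
    \<open>v\<close> to one with \<open>D\<close> \<le> \<open>y\<close>, where
    \<open>no_point_below_j\<close> bounds \<open>f\<close>.\<close>
  have U_shift: "D (c i + U) i = D (c i) i + U * a2" "f (c i + U) i = f (c i) i + U * (a2 - 1)" for i
    by (simp_all add: D_def f_def algebra_simps)
  define I A B where "I = {1..<int j}" and "A = {i \<in> I. v < D (c i) i}"
    and "B = {i \<in> I. D (c i) i \<le> v}"
  have D_inj: "D (c i) i \<noteq> D (c i') i'" if "1 \<le> i" "i < i'" "i' < int j" for i i'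
    using D_ne_0[of "i' - i" "c i' - c i"] that by (simp add: D_diff)
  have f_inj: "f (c i) i \<noteq> f (c i') i'" if "1 \<le> i" "i < i'" "i' < int j" for i i'
  proof
    assume "f (c i) i = f (c i') i'"
    then have 0: "f (c i' - c i) (i' - i) = 0" by (simp add: f_diff)
    then have "0 \<le> D (c i' - c i) (i' - i)" using that by (intro D_nonneg) auto
    then show False using 0 f_pos[of "i' - i" "c i' - c i"] that by simp
  qed
  have finI: "finite I" by (simp add: I_def)
  have "inj_on (\<lambda>i. D (c i) i) A"
    by (rule linorder_inj_onI') (use D_inj in \<open>auto simp: A_def I_def\<close>)
  moreover have "(\<lambda>i. D (c i) i) ` A \<subseteq> T"
    using avoid Dc_range by (auto simp: A_def I_def v_def)
  moreover have "finite T" using T finite_subset by blast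
  ultimately have cardA: "card A \<le> card T" by (rule card_inj_on_le)
  have "inj_on (\<lambda>i. f (c i) i) B"
    by (rule linorder_inj_onI') (use f_inj in \<open>auto simp: B_def I_def\<close>)
  moreover have "(\<lambda>i. f (c i) i) ` B \<subseteq> {1..v + U - n}"
  proof clarify
    fix i assume "i \<in> B"
    then have i: "1 \<le> i" "i < int j" "D (c i) i \<le> v" by (auto simp: B_def I_def)
    then have "f (c i + U) i \<le> y - n"
      by (intro no_point_below_j) (auto simp: U_shift y_eq)
    then have "f (c i) i \<le> v + U - n" unfolding U_shift y_eq by (simp add: algebra_simps)
    then show "f (c i) i \<in> {1..v + U - n}" using f_pos[of i "c i"] i Dc_range by simp
  qed
  ultimately have cardB: "card B \<le> card {1..v + U - n}" by (rule card_inj_on_le) simp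
  have "f U 0 \<le> y - n" using v j_pos by (intro no_point_below_j) (auto simp: D_def y_eq)
  then have nonneg: "0 \<le> v + U - n" by (simp add: f_def D_def y_eq)
  have "I = A \<union> B" by (auto simp: A_def B_def)
  then have "card I \<le> card A + card B" by (simp add: card_Un_le)
  moreover have "int (card I) = int j - 1" using j_pos by (simp add: I_def)
  moreover have "int (card {1..v + U - n}) = v + U - n" using nonneg by simp
  ultimately show ?thesis using cardA cardB unfolding v_def U_def by linarith
qed

text \<open>Counting all residues above \<open>v\<close> gives \<open>j\<close> \<le>
  \<open>a2 + U - n\<close>, which matches \<open>t_bound\<close> at \<open>t = U + 1\<close>. If
  that \<open>t\<close> is too large, one residue drops out and \<open>t = U\<close>
  suffices.\<close>

lemma order_bound:
  assumes t_bound: "\<And>t. 1 \<le> t \<Longrightarrow> t * a2 \<le> a3 \<Longrightarrow> t + a2 - 2 \<le> n + k"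
  shows "int j \<le> k + 1"
proof -
  define v U where "v = y mod a2" and "U = y div a2"
  have y_eq: "y = U * a2 + v" by (simp add: U_def v_def)
  have v: "0 \<le> v" "v < a2" using a2_gt_1 by (simp_all add: v_def)
  have U: "0 \<le> U" using y_range a2_gt_1 by (simp add: U_def pos_imp_zdiv_nonneg_iff)
  show ?thesis
  proof (cases "(U + 1) * a2 \<le> a3")
    case True
    have "int j \<le> 1 + int (card {v <.. a2 - 1}) + (v + U - n)"
      unfolding v_def U_def by (rule order_bound_aux) auto
    then show ?thesis using t_bound[of "U + 1"] True U v by simp
  next
    case False
    define r where "r = a3 - U * a2"
    have r: "v < r" "r < a2" using False y_range by (simp_all add: r_def y_eq algebra_simps)
    have "U \<noteq> 0" using False a2_less_a3 by auto
    then have U1: "1 \<le> U" using U by simp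
    have "int j \<le> 1 + int (card ({v <.. a2 - 1} - {r})) + (v + U - n)"
      unfolding v_def U_def
    proof (rule order_bound_aux)
      fix i c assume i: "1 \<le> i" "i < int j" "y mod a2 < D c i" "D c i < a2"
      \<comment> \<open>Value \<open>r\<close> at order \<open>i\<close> would give value 0 at order
        \<open>i + 1\<close>, which is still at most \<open>j\<close>.\<close>
      have "D c i \<noteq> r"
        using D_ne_0[of "i + 1" "c + U"] i by (auto simp: D_def r_def algebra_simps)
      then show "D c i \<in> {y mod a2 <.. a2 - 1} - {r}" using i by simp
    qed auto
    moreover have "int (card ({v <.. a2 - 1} - {r})) = a2 - 1 - v - 1"
      using r by (simp add: card_Diff_singleton of_nat_diff)
    moreover have "U * a2 \<le> a3" using r v by (simp add: r_def)
    ultimately show ?thesis using t_bound[of U] U1 by simp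
  qed
qed

section \<open>A late break and a canonical break exclude each other\<close>

text \<open>Here S may have order -1: for y = a3 - 1 it is the point (0, -1), where D = a3.\<close>

lemma obtain_Q_S:
  assumes cover: "\<forall>x\<in>{0..<a3}. \<exists>i<j. n_gen a2 a3 n i x"
    and x: "0 \<le> x" "x < a3" and n: "1 \<le> n" and none: "\<forall>i<j. \<not> n_gen a2 a3 (n - 1) i x"
  obtains cQ iQ cS iS where "0 \<le> iQ" "iQ < int j" "D cQ iQ \<le> x" "f cQ iQ = x - n"
    "-1 \<le> iS" "iS < int j" "D cS iS = x + 1" "x + 1 - n \<le> f cS iS" "x + 1 < a3 \<or> cS = 0 \<and> iS = -1"
proof -
  have "n \<le> x" using no_gen_0_ge none j_pos x by blast
  have none': "f c (int i) \<le> x - n" if "i < j" "D c (int i) \<le> x" for c i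
  proof (rule ccontr)
    assume "\<not> f c (int i) \<le> x - n"
    then have "n_gen a2 a3 (n - 1) (nat (int i)) x"
      using that \<open>n \<le> x\<close> by (intro n_genI) auto
    then show False using none that by simp
  qed
  obtain i where "i < j" "n_gen a2 a3 n i x" using bspec[OF cover, of x] x by auto
  then obtain cQ where i: "i < j" "D cQ (int i) \<le> x" "x - n \<le> f cQ (int i)"
    using n_genE by blast
  then have Q: "f cQ (int i) = x - n" using none'[of i cQ] by simp
  show thesis
  proof (cases "x + 1 < a3")
    case True
    then obtain i' where "i' < j" "n_gen a2 a3 n i' (x + 1)"
      using bspec[OF cover, of "x + 1"] x by auto
    then obtain cS where i': "i' < j" "D cS (int i') \<le> x + 1" "x + 1 - n \<le> f cS (int i')"
      using n_genE by blast
    \<comment> \<open>With \<open>D\<close> \<le> \<open>x\<close> the same point would be an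
      \<open>(n - 1)\<close>-generation of \<open>x\<close>.\<close>
    then have "D cS (int i') = x + 1" using none'[of i' cS] by fastforce
    then show thesis using i i' Q True that[of "int i" cQ "int i'" cS] by simp
  next
    case False
    then have "D 0 (-1) = x + 1" "x + 1 - n \<le> f 0 (-1)" using x n by (simp_all add: D_def f_def)
    then show thesis using i Q that[of "int i" cQ "-1" 0] by simp
  qed
qed

lemma no_canonical_break:
  assumes cover: "\<forall>x\<in>{0..<a3}. \<exists>i<j. n_gen a2 a3 n i x"
    and z: "0 \<le> z" "z < a3"
  shows "\<exists>i. n_gen a2 a3 (n - 1) i z"
proof (rule ccontr)
  assume "\<not> ?thesis"
  then have z_none: "\<And>i. \<not> n_gen a2 a3 (n - 1) i z" by blast
  have "n \<le> z" using no_gen_0_ge z_none z by blast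
  have z_empty: "f c i \<le> z - n" if "0 \<le> i" "D c i \<le> z" for c i
  proof (rule ccontr)
    assume "\<not> f c i \<le> z - n"
    then have "n_gen a2 a3 (n - 1) (nat i) z"
      using that \<open>n \<le> z\<close> by (intro n_genI) auto
    then show False using z_none by simp
  qed
  obtain cP where P: "D cP (int j) \<le> y" "y - n + 1 \<le> f cP (int j)" "0 \<le> D cP (int j)"
    by (rule obtain_P)
  have EP: "1 \<le> cP - int j" using excess_pos[of cP "int j"] P j_pos by simp
  then have n: "1 \<le> n" using P by (simp add: f_def)
  have y_none: "\<forall>i<j. \<not> n_gen a2 a3 (n - 1) i y" using no_gen_below_j by blast
  have z_none': "\<forall>i<j. \<not> n_gen a2 a3 (n - 1) i z" using z_none by blast
  obtain cQ iQ cS iS where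
      Q: "0 \<le> iQ" "iQ < int j" "D cQ iQ \<le> y" "f cQ iQ = y - n"
    and S: "-1 \<le> iS" "iS < int j" "D cS iS = y + 1" "y + 1 - n \<le> f cS iS" "y + 1 < a3 \<or> cS = 0 \<and> iS = -1"
    by (rule obtain_Q_S[OF cover y_range n y_none]) (rule that; assumption)
  obtain cQz iQz cSz iSz where
      Qz: "0 \<le> iQz" "iQz < int j" "D cQz iQz \<le> z" "f cQz iQz = z - n"
    and Sz: "-1 \<le> iSz" "iSz < int j" "D cSz iSz = z + 1" "z + 1 - n \<le> f cSz iSz"
    by (rule obtain_Q_S[OF cover z n z_none']) (rule that; assumption)
  define cV iV where "cV = cP - cQ" and "iV = int j - iQ"
  define cU iU where "cU = cS - cP" and "iU = iS - int j"
  define cX iX where "cX = cSz - cQz" and "iX = iSz - iQz"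
  note pts = cV_def iV_def cU_def iU_def cX_def iX_def
  have fV: "1 \<le> f cV iV" using P Q by (simp add: pts f_diff)
  have DU: "1 \<le> D cU iU" using P S by (simp add: pts D_diff)
  \<comment> \<open>At \<open>y + 1 = a3\<close> the bound \<open>D\<close> < \<open>a3\<close> of
    \<open>excess_mono\<close> fails for S, but there the excess of S is just 1.\<close>
  have "cS - iS \<le> cP - int j"
  proof (cases "y + 1 < a3")
    case True
    then show ?thesis using excess_mono[of iS "int j" cS cP] S P by simp
  next
    case False
    then show ?thesis using S EP by simp
  qed
  then have fU: "1 \<le> f cU iU" using DU by (simp add: pts f_def)
  have fX: "1 \<le> f cX iX" using Qz Sz by (simp add: pts f_diff)
  \<comment> \<open>Qz + V has \<open>f\<close> > \<open>z - n\<close> and nonnegative order, so it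
    must miss the empty quadrant of \<open>z\<close> through \<open>D\<close>.\<close>
  have "z + 1 \<le> D (cQz + cV) (iQz + iV)"
    using z_empty[of "iQz + iV" "cQz + cV"] Q Qz fV by (fastforce simp: f_add iV_def)
  then have DX_le: "D cX iX \<le> D cV iV" using Sz by (simp add: pts D_add D_diff)
  have DV: "D cV iV = D cP (int j) - D cQ iQ" by (simp add: pts D_diff)
  have DX: "D cX iX = z + 1 - D cQz iQz" using Sz by (simp add: pts D_diff)
  \<comment> \<open>Since \<open>f\<close> is exact at Q and Qz, \<open>y - D\<close> and
    \<open>z - D\<close> there equal \<open>n\<close> minus the excess.\<close>
  have EQ: "cQ - iQ < cQz - iQz" using DX_le DX DV P Q Qz by (simp add: f_def)
  have DQ: "0 \<le> D cQ iQ" using D_nonneg Q n_le_y by simp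
  show False
  proof (cases "0 \<le> iQ + iX")
    case True
    \<comment> \<open>Q + X lies in the quadrant of \<open>y\<close>, so its order is at least
      \<open>j\<close>; this forces \<open>iQz\<close> < \<open>iQ\<close>, and
      \<open>excess_mono\<close> contradicts \<open>EQ\<close>.\<close>
    have "D (cQ + cX) (iQ + iX) \<le> y" using DX_le DV P by (simp add: D_add)
    then have "int j \<le> iQ + iX"
      using no_point_below_j[of "iQ + iX" "cQ + cX"] True fX Q by (fastforce simp: f_add)
    then have "iQz < iQ" using Sz by (simp add: iX_def)
    then show False using excess_mono[of iQz iQ cQz cQ] Qz z DQ EQ by simp
  next
    case iX: False
    have EQz: "cQz - iQz \<le> cP - int j" using excess_mono[of iQz "int j" cQz cP] Qz z P by simp
    show False
    proof (cases "D cX iX \<le> D cU iU")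
      case True
      \<comment> \<open>With \<open>EQz\<close> this says that \<open>f\<close> at P is at most
        \<open>f\<close> at Q, against \<open>fV\<close>.\<close>
      then have "D cP (int j) - D cQ iQ \<le> (cQz - iQz) - (cQ - iQ)"
        using DX S Q Qz by (simp add: pts D_diff f_def)
      then show False using EQz P Q by (simp add: f_def)
    next
      case False
      have "D (cQz + cU) (iQz + iU) \<le> z" using False DX by (simp add: D_add)
      then have ord: "iQz + iU < 0"
        using z_empty[of "iQz + iU" "cQz + cU"] fU Qz by (fastforce simp: f_add)
      \<comment> \<open>W = X - U has \<open>D\<close> > 0 but \<open>f\<close> \<le> 0, which
        \<open>f_pos\<close> forbids. Its order stays within 0 and \<open>j\<close> even if S or Sz
        has order -1.\<close>
      define cW iW where "cW = cX - cU" and "iW = iX - iU"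
      have iW: "0 \<le> iW" "iW \<le> int j"
        using ord Sz S iX Q by (simp_all add: iW_def iX_def iU_def)
      have DW: "1 \<le> D cW iW" using False by (simp add: cW_def iW_def D_diff)
      have "D (cQz + cW) (iQz + iW) \<le> z" using DX DU by (simp add: D_add cW_def iW_def D_diff)
      then have fW: "f cW iW \<le> 0"
        using z_empty[of "iQz + iW" "cQz + cW"] iW Qz by (simp add: f_add)
      show False
      proof (cases "iW = 0")
        case True
        then have "0 < cW * a2" using DW by (simp add: D_def)
        then have "0 < cW" using a2_gt_1 by (simp add: zero_less_mult_iff)
        then have "0 < cW * (a2 - 1)" using a2_gt_1 by simp
        then show False using fW True by (simp add: f_def D_def algebra_simps)
      next
        case False
        then show False using f_pos[of iW cW] iW DW fW by simp
      qed
    qed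
  qed
qed

end

section \<open>Representations and the number X(h)\<close>

context two_steps
begin

text \<open>A representation with \<open>c3\<close> copies of \<open>a3\<close> is a generation of
  order \<open>m - c3\<close>; \<open>x\<close> < \<open>a3\<close> ensures \<open>c3\<close> \<le>
  \<open>m\<close>.\<close>

lemma h_rep_shift_iff:
  assumes "0 \<le> x" and "x < a3"
  shows "h_rep a2 a3 h (x + int m * a3) \<longleftrightarrow> (\<exists>i\<le>m. n_gen a2 a3 (h - int m) i x)"
proof
  assume "h_rep a2 a3 h (x + int m * a3)"
  then obtain c1 c2 c3 where c: "c1 \<ge> 0" "c2 \<ge> 0" "c3 \<ge> 0"
      "x + int m * a3 = c3 * a3 + c2 * a2 + c1" "c1 + c2 + c3 \<le> h"
    unfolding h_rep_def by blast
  have "0 \<le> c2 * a2 + c1" using c a2_gt_1 by simp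
  then have "c3 * a3 < (int m + 1) * a3" using c(4) assms by (simp add: algebra_simps)
  then have "c3 < int m + 1" using a2_gt_1 a2_less_a3 by (simp add: mult_less_cancel_right)
  then have i: "int (nat (int m - c3)) = int m - c3" by simp
  then have "n_gen a2 a3 (h - int m) (nat (int m - c3)) x"
    unfolding n_gen_def i using c
    by - (rule exI[of _ c1], rule exI[of _ c2], simp add: algebra_simps)
  moreover have "nat (int m - c3) \<le> m" using c(3) by simp
  ultimately show "\<exists>i\<le>m. n_gen a2 a3 (h - int m) i x" by blast
next
  assume "\<exists>i\<le>m. n_gen a2 a3 (h - int m) i x"
  then obtain i c1 c2 where "i \<le> m" "c1 \<ge> 0" "c2 \<ge> 0"
      "x + int i * a3 = c2 * a2 + c1" "c1 + c2 \<le> h - int m + int i"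
    unfolding n_gen_def by blast
  then show "h_rep a2 a3 h (x + int m * a3)"
    unfolding h_rep_def
    by - (rule exI[of _ c1], rule exI[of _ c2], rule exI[of _ "int m - int i"], simp add: algebra_simps)
qed

lemma h_rep_le:
  assumes "h_rep a2 a3 h x"
  shows "x \<le> h * a3"
proof -
  obtain c1 c2 c3 where c: "c1 \<ge> 0" "c2 \<ge> 0" "c3 \<ge> 0"
      "x = c3 * a3 + c2 * a2 + c1" "c1 + c2 + c3 \<le> h"
    using assms unfolding h_rep_def by blast
  have "c2 * a2 \<le> c2 * a3" using c a2_less_a3 by (intro mult_left_mono) auto
  moreover have "c1 * 1 \<le> c1 * a3"
    using c a2_gt_1 a2_less_a3 by (intro mult_left_mono) auto
  ultimately have "x \<le> (c1 + c2 + c3) * a3" using c(4) by (simp add: algebra_simps)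
  also have "\<dots> \<le> h * a3" using c(5) a2_gt_1 a2_less_a3 by (intro mult_right_mono) auto
  finally show ?thesis .
qed

lemma h_rep_Xh:
  assumes "0 < h"
  shows "\<not> h_rep a2 a3 h (Xh a2 a3 h + 1)"
    and "\<And>x. 0 \<le> x \<Longrightarrow> x \<le> Xh a2 a3 h \<Longrightarrow> h_rep a2 a3 h x"
proof -
  \<comment> \<open>\<open>LEAST\<close> on integers lacks well-ordering, so the minimum is taken
    over naturals and carried back; \<open>h_rep_le\<close> supplies a gap.\<close>
  define Q where "Q m \<longleftrightarrow> 0 < m \<and> \<not> h_rep a2 a3 h (int m)" for m
  have "0 < h * a3" using assms a2_gt_1 a2_less_a3 by simp
  then have "Q (nat (h * a3 + 1))" using h_rep_le[of h "h * a3 + 1"] by (auto simp: Q_def)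
  then have w: "Q (LEAST m. Q m)" by (rule LeastI)
  define w where "w = (LEAST m. Q m)"
  have least: "int w \<le> x" if "0 < x" "\<not> h_rep a2 a3 h x" for x
  proof -
    have "Q (nat x)" using that by (simp add: Q_def)
    then have "w \<le> nat x" unfolding w_def by (rule Least_le)
    then show ?thesis using that by simp
  qed
  have "(LEAST x::int. x > 0 \<and> \<not> h_rep a2 a3 h x) = int w"
    using w least by (intro Least_equality) (auto simp: Q_def w_def)
  then have Xh: "Xh a2 a3 h = int w - 1" by (simp add: Xh_def)
  then show "\<not> h_rep a2 a3 h (Xh a2 a3 h + 1)" using w by (simp add: Q_def w_def)
  have "h_rep a2 a3 h 0"
    unfolding h_rep_def using assms by (intro exI[of _ 0]) simp
  then show "h_rep a2 a3 h x" if "0 \<le> x" "x \<le> Xh a2 a3 h" for x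
    using least[of x] Xh that by (cases "x = 0") auto
qed

text \<open>The cheapest representation uses \<open>t - 1\<close> copies of \<open>a2\<close> and
  \<open>a2 - 1\<close> ones, since a copy of \<open>a2\<close> replaces \<open>a2\<close>
  ones.\<close>

lemma h_rep_digit_bound:
  assumes "h_rep a2 a3 h (t * a2 - 1)" and "t * a2 \<le> a3"
  shows "t + a2 - 2 \<le> h"
proof -
  obtain c1 c2 c3 where c: "c1 \<ge> 0" "c2 \<ge> 0" "c3 \<ge> 0"
      "t * a2 - 1 = c3 * a3 + c2 * a2 + c1" "c1 + c2 + c3 \<le> h"
    using assms(1) unfolding h_rep_def by blast
  have nn: "0 \<le> c2 * a2" "0 \<le> c3 * a3" using c a2_gt_1 a2_less_a3 by simp_all
  then have "c3 * a3 < 1 * a3" using c assms(2) by linarith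
  then have "c3 < 1" using a2_gt_1 a2_less_a3 by (simp add: mult_less_cancel_right)
  then have c3: "c3 = 0" using c(3) by simp
  then have "c2 * a2 < t * a2" using c(1,4) by simp
  then have "c2 < t" using a2_gt_1 by (simp add: mult_less_cancel_right)
  then have "c2 * (a2 - 1) \<le> (t - 1) * (a2 - 1)" using a2_gt_1 by (intro mult_right_mono) auto
  then show ?thesis using c c3 by (simp add: algebra_simps)
qed

end

section \<open>The canonical break Y + 1 and the conclusion\<close>

theorem theorem2:
  fixes a2 a3 h k Y :: int
  assumes "1 < a2" and "a2 < a3" and "0 < h"
    and "Xh a2 a3 h \<ge> a3"
    and "Xh a2 a3 h = (k + 1) * a3 + Y" and "0 \<le> Y" and "Y < a3"
  shows "(\<exists>p. stride_generator a2 a3 (h - k) p) \<and>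
         (\<forall>p. stride_generator a2 a3 (h - k) p \<longrightarrow> canonical_SG a2 a3 (h - k) p)"
proof -
  interpret two_steps a2 a3 using assms by unfold_locales
  define n where "n = h - k"
  note rep = h_rep_Xh(2)[OF \<open>0 < h\<close>] and not_rep = h_rep_Xh(1)[OF \<open>0 < h\<close>]
  have "0 < (k + 1) * a3" using assms by linarith
  then have "0 < k + 1" using assms by (simp add: zero_less_mult_iff)
  then obtain K where K: "k = int K" using zero_le_imp_eq_int[of k] by auto
  have Xh: "Xh a2 a3 h = int (K + 1) * a3 + Y" using assms K by (simp add: algebra_simps)
  have cover: "\<exists>i\<le>K. n_gen a2 a3 n i x" if x: "0 \<le> x" "x < a3" for x
  proof -
    have "0 \<le> x + int K * a3" using x by simp
    moreover have "x + int K * a3 \<le> Xh a2 a3 h" using x Xh assms by (simp add: algebra_simps)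
    ultimately have "h_rep a2 a3 h (x + int K * a3)" by (rule rep)
    then show ?thesis unfolding n_def K by (simp only: h_rep_shift_iff[OF x])
  qed
  \<comment> \<open>Otherwise \<open>(k + 2) * a3\<close> is the first gap, so \<open>k + 2\<close>
    > \<open>h\<close>, while its predecessor is at most \<open>h * a3\<close>; this leaves
    \<open>a3\<close> \<le> 1.\<close>
  have "Y + 1 \<noteq> a3"
  proof
    assume Y: "Y + 1 = a3"
    then have Xh': "Xh a2 a3 h + 1 = (k + 2) * a3" using assms by (simp add: algebra_simps)
    then have "\<not> h_rep a2 a3 h ((k + 2) * a3)" using not_rep by simp
    moreover have "h_rep a2 a3 h ((k + 2) * a3)" if "k + 2 \<le> h"
      unfolding h_rep_def using that K by - (rule exI[of _ 0], rule exI[of _ 0], rule exI[of _ "k + 2"], simp)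
    ultimately have "h + 1 \<le> k + 2" by fastforce
    then have "(h + 1) * a3 \<le> (k + 2) * a3" using assms by (intro mult_right_mono) auto
    moreover have "(k + 2) * a3 - 1 \<le> h * a3"
      using h_rep_le[OF rep[of "Xh a2 a3 h"]] assms(1-4) Xh' by simp
    ultimately show False using assms by (simp add: algebra_simps)
  qed
  define z where "z = Y + 1"
  have z: "0 \<le> z" "z < a3" using assms \<open>Y + 1 \<noteq> a3\<close> by (simp_all add: z_def)
  \<comment> \<open>\<open>z + (k + 1) * a3\<close> is the first gap X(h) + 1, and
    \<open>h - (k + 1)\<close> = \<open>n - 1\<close>.\<close>
  have z_none: "\<not> n_gen a2 a3 (n - 1) i z" if "i \<le> K + 1" for i
  proof -
    have "\<not> h_rep a2 a3 h (z + int (K + 1) * a3)"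
      using not_rep Xh by (simp add: z_def algebra_simps)
    then have "\<not> n_gen a2 a3 (h - int (K + 1)) i z" using h_rep_shift_iff[OF z] that by blast
    then show ?thesis by (simp add: n_def K algebra_simps)
  qed
  \<comment> \<open>\<open>t * a2 - 1\<close> is below \<open>a3\<close> \<le> X(h), hence
    representable.\<close>
  have t_bound: "t + a2 - 2 \<le> n + k" if "1 \<le> t" "t * a2 \<le> a3" for t
  proof -
    have "1 * a2 \<le> t * a2" using that assms by (intro mult_right_mono) auto
    then show ?thesis
      using h_rep_digit_bound[of h t] rep[of "t * a2 - 1"] that assms by (simp add: n_def)
  qed
  have z_canonical: "\<not> n_gen a2 a3 (n - 1) i z" for i
  proof
    assume gen: "n_gen a2 a3 (n - 1) i z"
    define j where "j = (LEAST i. n_gen a2 a3 (n - 1) i z)"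
    have j: "n_gen a2 a3 (n - 1) j z" unfolding j_def using gen by (rule LeastI)
    then have "K + 1 < j" using z_none by (meson not_le)
    moreover have "\<not> n_gen a2 a3 (n - 1) i z" if "i < j" for i
      using that unfolding j_def by (rule not_less_Least)
    then have "late_break a2 a3 n z j"
      using z j calculation by unfold_locales simp_all
    then have "int j \<le> k + 1" using t_bound by (rule late_break.order_bound)
    ultimately show False using K by simp
  qed
  have "\<exists>p. stride_generator a2 a3 n p"
  proof -
    \<comment> \<open>The least \<open>p\<close> with (A) satisfies (B) by minimality;
      \<open>z\<close> witnesses (C) for every \<open>p\<close>.\<close>
    define C where "C p \<longleftrightarrow> (\<forall>x. 0 \<le> x \<and> x < a3 \<longrightarrow> (\<exists>i\<le>p. n_gen a2 a3 n i x))" for p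
    define p where "p = (LEAST p. C p)"
    have "C K" using cover by (simp add: C_def)
    then have "C p" unfolding p_def by (rule LeastI)
    moreover have "\<exists>x. 0 \<le> x \<and> x < a3 \<and> \<not> (\<exists>i<p. n_gen a2 a3 n i x)"
    proof (cases p)
      case 0
      then show ?thesis using assms by (intro exI[of _ 0]) simp
    next
      case (Suc p')
      then have "\<not> C p'" using not_less_Least[of p' C] by (simp add: p_def)
      then show ?thesis unfolding C_def Suc less_Suc_eq_le by blast
    qed
    ultimately show ?thesis
      using z z_canonical unfolding stride_generator_def C_def by blast
  qed
  moreover have "canonical_SG a2 a3 n p" if SG: "stride_generator a2 a3 n p" for p
    unfolding canonical_SG_def canonical_break_def
  proof (intro conjI SG allI impI notI)
    fix y assume y: "is_break a2 a3 n p y" and "\<exists>j. n_gen a2 a3 (n - 1) j y"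
    define j where "j = (LEAST i. n_gen a2 a3 (n - 1) i y)"
    have j: "n_gen a2 a3 (n - 1) j y"
      unfolding j_def using \<open>\<exists>j. n_gen a2 a3 (n - 1) j y\<close> by (rule LeastI_ex)
    then have "p + 1 < j" using y unfolding is_break_def by (meson not_le)
    have below: "\<not> n_gen a2 a3 (n - 1) i y" if "i < j" for i
      using that unfolding j_def by (rule not_less_Least)
    have y_range: "0 \<le> y" "y < a3" using y by (simp_all add: is_break_def)
    interpret late_break a2 a3 n y j
      using y_range j below \<open>p + 1 < j\<close> by unfold_locales simp_all
    have "\<forall>x. 0 \<le> x \<and> x < a3 \<longrightarrow> (\<exists>i\<le>p. n_gen a2 a3 n i x)"
      using SG unfolding stride_generator_def by (rule conjunct1)
    \<comment> \<open>Orders up to \<open>p\<close> are below \<open>j\<close>, so (A) becomes the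
      covering hypothesis of \<open>no_canonical_break\<close>.\<close>
    moreover have "i < j" if "i \<le> p" for i using that \<open>p + 1 < j\<close> by simp
    ultimately have "\<forall>x\<in>{0..<a3}. \<exists>i<j. n_gen a2 a3 n i x" by (meson atLeastLessThan_iff)
    then show False using no_canonical_break z z_canonical by blast
  qed
  ultimately show ?thesis unfolding n_def by blast
qed

end
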